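(* Let $$\mathtt{F}_6(z)=\sum_{n=1}^{\infty}\frac{(-1)^{n-1}z^n}{(n-1)!\,(2n-1)\,n!}.$$ Then $\mathtt{F}_6\in\mathcal{S}^{\ast}(q_1)$. In general, $\mathtt{F}_6\in\mathcal{S}^{\ast}(q_c)$ for $c_0<c\le1$, where $c_0\approx0.577889$ is the root of the equation (in $c$) $$\left({}_1F_2\left(\tfrac12;\tfrac32,2;\tfrac{\sqrt[3]{21}}{2^{2/3}}\right)\right)^2-c\left({}_1F_2\left(\tfrac12;\tfrac32,2;1\right)\right)^2=1 .$$
   Context: $\mathbb{D}=\{z\in\mathbb{C}:|z|<1\}$; $(a)_0=1$, $(a)_n=a(a+1)\cdots(a+n-1)$; ${}_1F_2(a;b_1,b_2;x)=\sum_{n\ge0}\frac{(a)_n}{(b_1)_n(b_2)_n}\frac{x^n}{n!}$. (The function $\mathtt{F}_6$ is the Hadamard product of $\frac{\sqrt{\pi z}}{2}\operatorname{erf}(\sqrt z)$ with $e^z-1$.) For analytic $g,h$ on $\mathbb{D}$, $g\prec h$ (subordination) means $g=h\circ w$ for some analytic $w:\mathbb{D}\to\mathbb{D}$ with $w(0)=0$. Let $\mathcal{S}$ be the class of analytic univalent functions $f$ on $\mathbb{D}$ with $f(0)=0$, $f'(0)=1$. For $0<c\le1$, $\mathcal{S}^{\ast}(q_c)$ is the class of $f\in\mathcal{S}$ with $zf'(z)/f(z)\prec\sqrt{1+cz}$ (principal branch; the quotient equals $1$ at $z=0$). *)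

theory Defs
  imports "HOL-Analysis.Analysis"
begin

abbreviation unit_disc :: "complex set"  ("\<D>")
  where "\<D> \<equiv> ball 0 1"

definition hyp1F2 ::
    "'a::{real_normed_field,banach} \<Rightarrow> 'a \<Rightarrow> 'a \<Rightarrow> 'a \<Rightarrow> 'a"
  where "hyp1F2 a b1 b2 x =
    (\<Sum>n. pochhammer a n / (pochhammer b1 n * pochhammer b2 n) * (x ^ n / fact n))"

definition subordinate :: "(complex \<Rightarrow> complex) \<Rightarrow> (complex \<Rightarrow> complex) \<Rightarrow> bool"
    (infix "\<prec>\<^sub>s" 50)
  where "g \<prec>\<^sub>s h \<longleftrightarrow>
    g holomorphic_on \<D> \<and> h holomorphic_on \<D> \<and>
    (\<exists>w. w holomorphic_on \<D> \<and> w ` \<D> \<subseteq> \<D> \<and> w 0 = 0 \<and> (\<forall>z\<in>\<D>. g z = h (w z)))"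

definition class_S :: "(complex \<Rightarrow> complex) set"
  where "class_S = {f. f holomorphic_on \<D> \<and> inj_on f \<D> \<and> f 0 = 0 \<and> deriv f 0 = 1}"

text \<open>The case distinction fills in the removable singularity of \<open>z f'(z) / f(z)\<close> at the origin,
  where division by zero would give 0.\<close>

definition log_deriv_quot :: "(complex \<Rightarrow> complex) \<Rightarrow> complex \<Rightarrow> complex"
  where "log_deriv_quot f z = (if z = 0 then 1 else z * deriv f z / f z)"

definition q :: "real \<Rightarrow> complex \<Rightarrow> complex"
  where "q c z = csqrt (1 + of_real c * z)"

text \<open>Meaningful for \<open>0 < c \<le> 1\<close>, where \<open>1 + c z\<close> stays in the right half-plane for \<open>z\<close> in the
  disc.\<close>

definition starlike_q :: "real \<Rightarrow> (complex \<Rightarrow> complex) set"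
  where "starlike_q c = {f \<in> class_S. log_deriv_quot f \<prec>\<^sub>s q c}"

text \<open>The series with \<open>n\<close>-th term
  \<open>(-1)^(n-1) z^n / ((n-1)! (2n-1) n!)\<close>, \<open>n \<ge> 1\<close>, with \<open>n\<close> shifted by one so that the
  summation starts at 0.\<close>

definition F6 :: "complex \<Rightarrow> complex"
  where "F6 z = (\<Sum>n. (-1) ^ n * z ^ (n + 1) / (fact n * of_nat (2 * n + 1) * fact (n + 1)))"

end

(* Write F6 z = z G(z). Bounding the power series termwise gives 4 |z G'(z)| + |G(z) - 1| < 1 on the
   disc. Hence |F6' - 1| < 1, which makes F6 injective, and Q = z F6' / F6 = 1 + z G' / G satisfies
   |Q - 1| <= 1/4, so |Q^2 - 1| <= 9/16 < c0 and (Q^2 - 1) / c is the required Schwarz function. *)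

theory Submission
  imports Defs "HOL-Complex_Analysis.Cauchy_Integral_Formula"
begin

section \<open>Series whose terms eventually halve\<close>

text \<open>From index \<open>N\<close> on, the geometric series with first term \<open>a N\<close>
  and ratio 1/2 dominates, so the tail is at most \<open>2 * a N\<close>. This reduces every
  numerical estimate below to a finite rational sum.\<close>

lemma halving_sequence_sums:
  fixes a :: "nat \<Rightarrow> real"
  assumes nonneg: "\<And>n. 0 \<le> a n" and halving: "\<And>n. n \<ge> N \<Longrightarrow> a (Suc n) \<le> a n / 2"
  shows "summable a" "suminf a \<le> sum a {..<N} + 2 * a N" "sum a {..<N} \<le> suminf a"
proof -
  have le: "a (k + N) \<le> a N * (1/2) ^ k" for k
  proof (induction k)
    case (Suc k)
    have "a (Suc k + N) \<le> a (k + N) / 2" using halving[of "k + N"] by simp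
    with Suc show ?case by simp
  qed simp
  have geo: "(\<lambda>k. a N * (1/2) ^ k) sums (a N * 2)"
    using sums_mult[OF geometric_sums[of "1/2::real"], of "a N"] by simp
  have tail: "summable (\<lambda>k. a (k + N))"
    by (rule summable_comparison_test'[OF sums_summable[OF geo], of 0]) (use le nonneg in auto)
  then show sm: "summable a" by (simp add: summable_iff_shift)
  have "(\<Sum>k. a (k + N)) \<le> a N * 2"
    using suminf_le[OF le tail sums_summable[OF geo]] sums_unique[OF geo] by simp
  then show "suminf a \<le> sum a {..<N} + 2 * a N"
    using suminf_split_initial_segment[OF sm, of N] by simp
  show "sum a {..<N} \<le> suminf a"
    using nonneg by (intro sum_le_suminf[OF sm]) auto
qed

section \<open>Coefficients and rational enclosures of the hypergeometric values\<close>

text \<open>These are at once the Taylor coefficients of 1F2(1/2; 3/2, 2; x) and, up to sign, those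
  of \<open>F6 z / z\<close>.\<close>

definition hyp_coeff :: "nat \<Rightarrow> real"
  where "hyp_coeff n = 1 / (fact n * of_nat (2 * n + 1) * fact (n + 1))"

lemma hyp_coeff_pos: "0 < hyp_coeff n"
  unfolding hyp_coeff_def by (intro divide_pos_pos mult_pos_pos) auto

lemma hyp_coeff_Suc:
  "hyp_coeff (Suc n) = hyp_coeff n * ((2 * n + 1) / ((n + 1) * (n + 2) * (2 * n + 3)))"
proof -
  have Suc: "hyp_coeff (Suc n) =
      1 / ((real n + 1) * fact n * (2 * real n + 3) * ((real n + 2) * ((real n + 1) * fact n)))"
    by (simp add: hyp_coeff_def algebra_simps)
  have same: "hyp_coeff n = 1 / (fact n * (2 * real n + 1) * ((real n + 1) * fact n))"
    by (simp add: hyp_coeff_def algebra_simps)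
  have "2 * real n + 1 \<noteq> 0" "2 * real n + 3 \<noteq> 0" "real n + 1 \<noteq> 0" "real n + 2 \<noteq> 0"
    by linarith+
  then show ?thesis
    unfolding Suc same by (simp add: divide_simps)
qed

text \<open>The quotient (1/2)_n / (3/2)_n telescopes to 1 / (2n + 1), and (2)_n = (n + 1)!.\<close>

lemma hyp1F2_conv_hyp_coeff: "hyp1F2 (1/2) (3/2) 2 (x::real) = (\<Sum>n. hyp_coeff n * x ^ n)"
proof -
  have half: "pochhammer (1/2::real) n * (2 * n + 1) = pochhammer (3/2) n" for n
  proof (induction n)
    case (Suc n)
    then show ?case
      by (simp add: pochhammer_Suc field_simps)
  qed simp
  have two: "pochhammer (2::real) n = fact (n + 1)" for n
    using pochhammer_rec[of "1::real" n] pochhammer_fact[of "Suc n", where ?'a = real] by simp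
  have nz: "pochhammer (1/2::real) n \<noteq> 0" for n
    by (metis half_gt_zero_iff less_irrefl pochhammer_pos zero_less_one)
  have "pochhammer (1/2) n / (pochhammer (3/2) n * pochhammer 2 n) * (x ^ n / fact n)
      = hyp_coeff n * x ^ n" for n
    unfolding half[symmetric] two hyp_coeff_def using nz[of n] by simp
  then show ?thesis unfolding hyp1F2_def by simp
qed

text \<open>The coefficient ratio is O(1/n^2), and the proof treats the worst case
  \<open>x = 2\<close>. The range up to 2 covers both arguments in the equation for
  \<open>c\<^sub>0\<close>, namely 1 and about 1.738.\<close>

lemma hyp_coeff_halving:
  assumes "0 \<le> x" "x \<le> 2" "1 \<le> n"
  shows "hyp_coeff (Suc n) * x ^ Suc n \<le> hyp_coeff n * x ^ n / 2"
proof -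
  have "real n \<ge> 1" using assms by simp
  \<comment> \<open>After expansion the inequality is linear in the powers of \<open>n\<close>, so
    lower bounds on these monomials suffice.\<close>
  then have "real n * n \<ge> 1" "real n * n * n \<ge> 1" 
    by (simp_all add: mult_ge1_I)
  then have "2 * (2 * real n + 1) \<le> 1/2 * ((n + 1) * (n + 2) * (2 * n + 3))"
    by (simp add: algebra_simps)
  then have "(2 * real n + 1) / ((n + 1) * (n + 2) * (2 * n + 3)) * 2 \<le> 1 / 2"
    by (simp add: divide_simps)
  moreover have "(2 * real n + 1) / ((n + 1) * (n + 2) * (2 * n + 3)) * x
      \<le> (2 * real n + 1) / ((n + 1) * (n + 2) * (2 * n + 3)) * 2"
    using assms by (intro mult_left_mono) auto
  ultimately have "(2 * real n + 1) / ((n + 1) * (n + 2) * (2 * n + 3)) * x \<le> 1 / 2"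
    by linarith
  then have "(hyp_coeff n * x ^ n) * ((2 * real n + 1) / ((n + 1) * (n + 2) * (2 * n + 3)) * x)
      \<le> (hyp_coeff n * x ^ n) * (1 / 2)"
    using assms hyp_coeff_pos[of n] by (intro mult_left_mono) auto
  then show ?thesis by (simp add: hyp_coeff_Suc algebra_simps)
qed

lemma hyp1F2_bounds:
  fixes x :: real
  assumes "0 \<le> x" "x \<le> 2" "1 \<le> N"
  shows "(\<Sum>n<N. hyp_coeff n * x ^ n) \<le> hyp1F2 (1/2) (3/2) 2 x"
    "hyp1F2 (1/2) (3/2) 2 x \<le> (\<Sum>n<N. hyp_coeff n * x ^ n) + 2 * (hyp_coeff N * x ^ N)"
  unfolding hyp1F2_conv_hyp_coeff
  using assms hyp_coeff_pos hyp_coeff_halving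
  by (intro halving_sequence_sums; simp add: less_imp_le)+

text \<open>Termwise, since the coefficients are positive. It transfers bounds at rational arguments
  to the irrational cube root between them.\<close>

lemma hyp1F2_mono:
  fixes x y :: real
  assumes "0 \<le> x" "x \<le> y" "y \<le> 2"
  shows "hyp1F2 (1/2) (3/2) 2 x \<le> hyp1F2 (1/2) (3/2) 2 y"
proof -
  have "summable (\<lambda>n. hyp_coeff n * u ^ n)" if "0 \<le> u" "u \<le> 2" for u
    by (rule halving_sequence_sums(1)[of _ 1])
      (use that hyp_coeff_pos hyp_coeff_halving in \<open>auto simp: less_imp_le\<close>)
  then show ?thesis
    unfolding hyp1F2_conv_hyp_coeff using assms hyp_coeff_pos
    by (intro suminf_le) (auto intro!: mult_left_mono power_mono simp: less_imp_le)
qed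

lemma hyp1F2_at_1:
  "1.18436505 \<le> hyp1F2 (1/2) (3/2) 2 (1::real)"
  "hyp1F2 (1/2) (3/2) 2 (1::real) \<le> 1.184365051"
proof -
  show "1.18436505 \<le> hyp1F2 (1/2) (3/2) 2 (1::real)"
    by (rule order_trans[OF _ hyp1F2_bounds(1)[of 1 10]])
      (simp_all add: eval_nat_numeral hyp_coeff_def)
  show "hyp1F2 (1/2) (3/2) 2 (1::real) \<le> 1.184365051"
    by (rule order_trans[OF hyp1F2_bounds(2)[of 1 9]])
      (simp_all add: eval_nat_numeral hyp_coeff_def)
qed

text \<open>The cube of this number is 21/4, so each decimal bound reduces to comparing rational
  cubes.\<close>

lemma critical_point_bounds:
  "1.7380133 \<le> root 3 21 / 2 powr (2/3)" "root 3 21 / 2 powr (2/3) \<le> 1.7380134"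
  "root 3 21 / 2 powr (2/3) \<le> (2::real)"
proof -
  let ?X = "root 3 21 / 2 powr (2/3) :: real"
  have "(2 powr (2/3)) ^ 3 = (4::real)"
    by (simp add: powr_power)
  then have cube: "?X ^ 3 = 21 / 4"
    by (simp add: power_divide)
  have nonneg: "0 \<le> ?X" by simp
  show "1.7380133 \<le> ?X"
    \<comment> \<open>The rule compares powers with exponent \<open>Suc n\<close>, so the instance 2
      means cubes.\<close>
    by (rule power_le_imp_le_base[of _ 2])
      (use cube nonneg in \<open>simp_all add: power_divide numeral_3_eq_3[symmetric]\<close>)
  show upper: "?X \<le> 1.7380134"
    by (rule power_le_imp_le_base[of _ 2])
      (use cube nonneg in \<open>simp_all add: power_divide numeral_3_eq_3[symmetric]\<close>)
  show "?X \<le> 2"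
    by (rule order_trans[OF upper]) simp
qed

lemma hyp1F2_at_critical_point:
  "1.34559136 \<le> hyp1F2 (1/2) (3/2) 2 (root 3 21 / 2 powr (2/3) :: real)"
  "hyp1F2 (1/2) (3/2) 2 (root 3 21 / 2 powr (2/3) :: real) \<le> 1.3455915"
proof -
  have "1.34559136 \<le> hyp1F2 (1/2) (3/2) 2 (1.7380133 :: real)"
    by (rule order_trans[OF _ hyp1F2_bounds(1)[of _ 10]])
      (simp_all add: eval_nat_numeral hyp_coeff_def)
  then show "1.34559136 \<le> hyp1F2 (1/2) (3/2) 2 (root 3 21 / 2 powr (2/3) :: real)"
    by (rule order_trans) (intro hyp1F2_mono critical_point_bounds; simp)
  have "hyp1F2 (1/2) (3/2) 2 (1.7380134 :: real) \<le> 1.3455915"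
    by (rule order_trans[OF hyp1F2_bounds(2)[of _ 9]])
      (simp_all add: eval_nat_numeral hyp_coeff_def)
  then show "hyp1F2 (1/2) (3/2) 2 (root 3 21 / 2 powr (2/3) :: real) \<le> 1.3455915"
    by (rule order_trans[rotated]) (intro hyp1F2_mono critical_point_bounds; simp)
qed

section \<open>The power series of \<open>F6 z / z\<close> and its estimate on the disc\<close>

text \<open>The weight \<open>4 * n + 1\<close> collects a contribution \<open>4 * n\<close> from 4
  |z G'| and 1 from |G|. The term at 0 equals 1, so the total must stay below 2. Halving is applied
  from index 4, where the bound is about 1.9975; cutting at 3 would give about 2.009, which is too
  large.\<close>

lemma weighted_hyp_coeff_sum:
  shows "summable (\<lambda>n. (4 * real n + 1) * hyp_coeff n)"
    and "(\<Sum>n. (4 * real n + 1) * hyp_coeff n) \<le> 1.998"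
proof -
  have step: "(4 * real (Suc n) + 1) * hyp_coeff (Suc n) \<le> (4 * real n + 1) * hyp_coeff n / 2"
    if "4 \<le> n" for n
  proof -
    have n: "real n \<ge> 4" using that by simp
    then have m: "0 \<le> real n * n" "0 \<le> real n * n * n" "0 \<le> real n * n * n * n"
      by auto
    let ?P = "(real n + 1) * (real n + 2) * (2 * real n + 3)"
    have P: "0 < ?P" using n by simp
    have "2 * ((4 * real n + 5) * (2 * real n + 1)) \<le> (4 * real n + 1) * ?P"
      using n m by (simp only: algebra_simps)
    then have "(4 * real n + 5) * ((2 * real n + 1) / ?P) \<le> (4 * real n + 1) / 2"
      using P by (simp only: times_divide_eq_right pos_divide_le_eq)
    then have "hyp_coeff n * ((4 * real n + 5) * ((2 * real n + 1) / ?P))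
        \<le> hyp_coeff n * ((4 * real n + 1) / 2)"
      by (intro mult_left_mono less_imp_le[OF hyp_coeff_pos])
    then show ?thesis by (simp add: hyp_coeff_Suc algebra_simps)
  qed
  have nonneg: "0 \<le> (4 * real n + 1) * hyp_coeff n" for n
    using hyp_coeff_pos[of n] by simp
  note * = halving_sequence_sums[of "\<lambda>n. (4 * real n + 1) * hyp_coeff n" 4, OF nonneg step]
  show "summable (\<lambda>n. (4 * real n + 1) * hyp_coeff n)" using *(1) by simp
  show "(\<Sum>n. (4 * real n + 1) * hyp_coeff n) \<le> 1.998"
    by (rule order_trans[OF *(2)]) (simp_all add: eval_nat_numeral hyp_coeff_def)
qed

text \<open>This is G, that is 1F2(1/2; 3/2, 2; -z). Defining it by its series rather than as a
  quotient gives the value 1 at the origin.\<close>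

definition F6_quot :: "complex \<Rightarrow> complex"
  where "F6_quot z = (\<Sum>n. of_real ((-1) ^ n * hyp_coeff n) * z ^ n)"

text \<open>Domination by the exponential series gives convergence on the whole plane, so termwise
  differentiation is valid at every point.\<close>

lemma F6_quot_summable: "summable (\<lambda>n. of_real ((-1) ^ n * hyp_coeff n) * (z::complex) ^ n)"
proof (rule summable_comparison_test'[of _ 0])
  show "summable (\<lambda>n. norm z ^ n /\<^sub>R fact n)"
    by (rule summable_exp_generic)
  fix n
  have "1 \<le> real (2 * n + 1) * fact (n + 1)"
    by (rule mult_ge1_I) (simp, rule fact_ge_1)
  then have "hyp_coeff n \<le> 1 / fact n"
    by (simp add: hyp_coeff_def divide_simps mult.assoc)
  then show "norm (of_real ((-1) ^ n * hyp_coeff n) * z ^ n) \<le> norm z ^ n /\<^sub>R fact n"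
    using hyp_coeff_pos[of n] mult_right_mono[of "hyp_coeff n" "1 / fact n" "norm z ^ n"]
    by (simp add: norm_mult norm_power divide_inverse)
qed

lemma F6_conv_quot: "F6 z = z * F6_quot z"
proof -
  have "z * F6_quot z = (\<Sum>n. z * (of_real ((-1) ^ n * hyp_coeff n) * z ^ n))"
    unfolding F6_quot_def by (rule suminf_mult[OF F6_quot_summable, symmetric])
  also have "(\<lambda>n. z * (of_real ((-1) ^ n * hyp_coeff n) * z ^ n)) =
      (\<lambda>n. (-1) ^ n * z ^ (n + 1) / (fact n * of_nat (2 * n + 1) * fact (n + 1)))"
    by (rule ext) (simp add: hyp_coeff_def mult.commute)
  finally show ?thesis unfolding F6_def by simp
qed

lemma F6_quot_has_derivative:
  "(F6_quot has_field_derivative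
     (\<Sum>n. diffs (\<lambda>n. of_real ((-1) ^ n * hyp_coeff n)) n * z ^ n)) (at z)"
  unfolding F6_quot_def[abs_def]
  by (rule termdiffs_strong_converges_everywhere[OF F6_quot_summable])

lemma F6_quot_0: "F6_quot 0 = 1"
  unfolding F6_quot_def powser_zero by (simp add: hyp_coeff_def)

lemma F6_quot_deriv_sums:
  "(\<lambda>n. of_real ((-1) ^ n * hyp_coeff n * n) * z ^ n) sums (z * deriv F6_quot z)"
proof -
  let ?c = "\<lambda>n. of_real ((-1) ^ n * hyp_coeff n) :: complex"
  have "(\<lambda>n. of_nat n * ?c n * z ^ (n - Suc 0)) sums (\<Sum>n. diffs ?c n * z ^ n)"
    by (rule diffs_equiv[OF termdiff_converges_all[OF F6_quot_summable]])
  then have "(\<lambda>n. of_nat n * ?c n * z ^ (n - Suc 0)) sums deriv F6_quot z"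
    using DERIV_imp_deriv[OF F6_quot_has_derivative] by simp
  then have "(\<lambda>n. z * (of_nat n * ?c n * z ^ (n - Suc 0))) sums (z * deriv F6_quot z)"
    by (rule sums_mult)
  \<comment> \<open>At \<open>n = 0\<close> the truncated exponent is harmless, because the factor
    \<open>n\<close> makes both sides vanish.\<close>
  moreover have "z * (of_nat n * ?c n * z ^ (n - Suc 0)) = of_real ((-1) ^ n * hyp_coeff n * n) * z ^ n" for n
    by (cases n) (simp_all add: mult_ac)
  ultimately show ?thesis by (simp only:)
qed

text \<open>Absolute values are taken termwise with |z|^n \<le> 1. Subtracting 1 from G removes the
  term at 0, so the bound is 1.998 - 1 = 499/500.\<close>

lemma F6_quot_estimate:
  assumes "norm z \<le> 1"
  shows "4 * norm (z * deriv F6_quot z) + norm (F6_quot z - 1) \<le> 499/500"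
proof -
  let ?d = "\<lambda>n. of_real ((-1) ^ n * hyp_coeff n * n) * z ^ n"
  let ?c = "\<lambda>n. of_real ((-1) ^ n * hyp_coeff n) * z ^ n"
  let ?w = "\<lambda>n. (4 * real n + 1) * hyp_coeff n"
  have pw: "norm z ^ n \<le> 1" for n
    using assms by (simp add: power_le_one)
  have d_le: "norm (?d n) \<le> real n * hyp_coeff n" for n
    using mult_left_mono[OF pw[of n], of "real n * hyp_coeff n"] hyp_coeff_pos[of n]
    by (simp add: norm_mult norm_power mult_ac)
  have c_le: "norm (?c n) \<le> hyp_coeff n" for n
    using mult_left_mono[OF pw[of n], of "hyp_coeff n"] hyp_coeff_pos[of n]
    by (simp add: norm_mult norm_power)
  have sm1: "summable (\<lambda>n. real n * hyp_coeff n)" and sm0: "summable hyp_coeff"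
    by (rule summable_comparison_test'[OF weighted_hyp_coeff_sum(1), of 0];
        use hyp_coeff_pos in \<open>simp add: less_imp_le algebra_simps\<close>)+
  have "norm (z * deriv F6_quot z) \<le> (\<Sum>n. real n * hyp_coeff n)"
    unfolding sums_unique[OF F6_quot_deriv_sums]
    by (rule norm_suminf_le[OF d_le sm1])
  moreover have "norm (F6_quot z - 1) \<le> (\<Sum>n. hyp_coeff (Suc n))"
  proof -
    have "F6_quot z - 1 = (\<Sum>n. ?c (Suc n))"
      using suminf_split_head[OF F6_quot_summable[of z]]
      by (simp add: F6_quot_def hyp_coeff_def)
    also have "norm \<dots> \<le> (\<Sum>n. hyp_coeff (Suc n))"
      by (rule norm_suminf_le[OF c_le]) (simp add: sm0 summable_Suc_iff)
    finally show ?thesis .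
  qed
  moreover have "(\<Sum>n. hyp_coeff (Suc n)) = (\<Sum>n. hyp_coeff n) - 1"
    using suminf_split_head[OF sm0] hyp_coeff_def[of 0] by simp
  moreover have "(\<Sum>n. ?w n) = 4 * (\<Sum>n. real n * hyp_coeff n) + (\<Sum>n. hyp_coeff n)"
    using suminf_add[OF summable_mult[OF sm1, of 4] sm0] suminf_mult[OF sm1, of 4]
    by (simp add: algebra_simps)
  ultimately show ?thesis
    using weighted_hyp_coeff_sum(2) by simp
qed

section \<open>Univalence of \<open>F6\<close>\<close>

lemma F6_has_derivative:
  "(F6 has_field_derivative (F6_quot z + z * deriv F6_quot z)) (at z)"
proof -
  have "(F6_quot has_field_derivative deriv F6_quot z) (at z)"
    using F6_quot_has_derivative[of z] DERIV_imp_deriv by metis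
  then have "((\<lambda>z. z * F6_quot z) has_field_derivative (F6_quot z + z * deriv F6_quot z)) (at z)"
    by (auto intro!: derivative_eq_intros)
  then show ?thesis by (simp add: F6_conv_quot[abs_def])
qed

text \<open>On the convex disc, \<open>F6 u - u\<close> is Lipschitz with constant 499/500 < 1. Two
  points with the same image under \<open>F6\<close> would be moved apart by exactly their distance,
  so they coincide.\<close>

lemma F6_inj: "inj_on F6 \<D>"
proof (rule inj_onI)
  fix z w :: complex assume zw: "z \<in> \<D>" "w \<in> \<D>" "F6 z = F6 w"
  have "norm ((F6 z - z) - (F6 w - w)) \<le> 499/500 * norm (z - w)"
  proof (rule field_differentiable_bound[OF convex_ball _ _ zw(1,2)])
    fix u :: complex assume u: "u \<in> \<D>"
    show "((\<lambda>u. F6 u - u) has_field_derivative (F6_quot u + u * deriv F6_quot u - 1)) (at u within \<D>)"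
      by (rule DERIV_diff[OF has_field_derivative_at_within[OF F6_has_derivative]]) simp
    have "norm (F6_quot u + u * deriv F6_quot u - 1)
        \<le> norm (F6_quot u - 1) + norm (u * deriv F6_quot u)"
      by (metis add_diff_eq add.commute norm_triangle_ineq)
    also have "\<dots> \<le> 499/500"
      using F6_quot_estimate[of u] u norm_ge_zero[of "u * deriv F6_quot u"]
      unfolding mem_ball_0 by linarith
    finally show "norm (F6_quot u + u * deriv F6_quot u - 1) \<le> 499/500" .
  qed
  moreover have "norm ((F6 z - z) - (F6 w - w)) = norm (z - w)"
    using zw(3) by (simp add: norm_minus_commute)
  ultimately show "z = w" by simp
qed

lemma F6_class_S: "F6 \<in> class_S"
proof -
  have "F6 holomorphic_on \<D>"
    using F6_has_derivative by (auto simp: holomorphic_on_def field_differentiable_def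
        intro: has_field_derivative_at_within)
  moreover have "deriv F6 0 = 1"
    using DERIV_imp_deriv[OF F6_has_derivative[of 0]] by (simp add: F6_quot_0)
  ultimately show ?thesis
    by (simp add: class_S_def F6_inj F6_conv_quot)
qed

section \<open>Subordination to the square root\<close>

text \<open>Solving g = sqrt(1 + c w) for w gives the only candidate (g^2 - 1) / c. The norm bound
  puts it in the disc, and the positive real part of g selects the principal branch.\<close>

lemma subordinate_q:
  assumes holo: "g holomorphic_on \<D>" and g0: "g 0 = 1"
    and Re_pos: "\<And>z. z \<in> \<D> \<Longrightarrow> 0 < Re (g z)"
    and bound: "\<And>z. z \<in> \<D> \<Longrightarrow> norm ((g z)\<^sup>2 - 1) < c"
    and c: "0 < c" "c \<le> 1"
  shows "g \<prec>\<^sub>s q c"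
proof -
  let ?w = "\<lambda>z. ((g z)\<^sup>2 - 1) / of_real c"
  have "q c holomorphic_on \<D>"
    unfolding q_def[abs_def]
  \<comment> \<open>With \<open>c \<le> 1\<close> the radicand stays in the right half-plane, away
    from the branch cut.\<close>
  proof (rule holomorphic_on_csqrt')
    fix z :: complex assume "z \<in> \<D>"
    then have "norm (of_real c * z) < 1"
      using c mult_left_le_one_le[of "norm z" c] by (simp add: norm_mult)
    then have "0 < Re (1 + of_real c * z)"
      using abs_Re_le_cmod[of "of_real c * z"] by simp
    then show "1 + of_real c * z \<notin> \<real>\<^sub>\<le>\<^sub>0"
      by (meson complex_nonpos_Reals_iff not_le)
  qed (intro holomorphic_intros)
  moreover have "?w holomorphic_on \<D>"
    using c by (intro holomorphic_intros holo) auto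
  moreover have "?w ` \<D> \<subseteq> \<D>"
    using bound c by (auto simp: norm_divide)
  moreover have "g z = q c (?w z)" if "z \<in> \<D>" for z
    using csqrt_square[of "g z"] Re_pos[OF that] c by (simp add: q_def)
  ultimately show ?thesis
    unfolding subordinate_def using holo g0 by (intro conjI exI[of _ ?w]) auto
qed

text \<open>The estimate leaves 4 |z G'| < 1 - |G - 1| \<le> |G|, so G has no zero and |Q - 1| \<le>
  1/4. Then |Q + 1| \<le> 9/4, and the threshold 9/16 is the product of these bounds.\<close>

lemma F6_starlike_q:
  assumes "9/16 < c" "c \<le> 1"
  shows "F6 \<in> starlike_q c"
proof -
  have quot_ne: "F6_quot z \<noteq> 0" and
    close: "norm (log_deriv_quot F6 z - 1) \<le> 1/4" and
    eq: "log_deriv_quot F6 z = (F6_quot z + z * deriv F6_quot z) / F6_quot z"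
    if "z \<in> \<D>" for z
  proof -
    have est: "4 * norm (z * deriv F6_quot z) + norm (F6_quot z - 1) \<le> 499/500"
      using that by (intro F6_quot_estimate) simp
    have tri: "1 \<le> norm (F6_quot z) + norm (F6_quot z - 1)"
      using norm_triangle_ineq4[of "F6_quot z" "F6_quot z - 1"] by simp
    have "0 < norm (F6_quot z)"
      using est tri norm_ge_zero[of "z * deriv F6_quot z"] by linarith
    then show nz: "F6_quot z \<noteq> 0" by simp
    \<comment> \<open>Away from 0 a factor \<open>z\<close> cancels; at 0 both sides are 1. The
      right-hand side thus shows that the quotient is holomorphic across the origin.\<close>
    show eq: "log_deriv_quot F6 z = (F6_quot z + z * deriv F6_quot z) / F6_quot z"
      using DERIV_imp_deriv[OF F6_has_derivative[of z]] nz
      by (simp add: log_deriv_quot_def F6_conv_quot F6_quot_0)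
    have "log_deriv_quot F6 z - 1 = z * deriv F6_quot z / F6_quot z"
      using nz by (simp add: eq add_divide_distrib)
    then show "norm (log_deriv_quot F6 z - 1) \<le> 1/4"
      using est tri \<open>0 < norm (F6_quot z)\<close> by (simp add: norm_divide pos_divide_le_eq)
  qed
  have quot_holo: "F6_quot holomorphic_on \<D>"
    using F6_quot_has_derivative by (auto simp: holomorphic_on_def field_differentiable_def
        intro: has_field_derivative_at_within)
  have "(\<lambda>z. (F6_quot z + z * deriv F6_quot z) / F6_quot z) holomorphic_on \<D>"
    by (intro holomorphic_intros holomorphic_deriv quot_holo quot_ne open_ball)
  then have holo: "log_deriv_quot F6 holomorphic_on \<D>"
    by (rule holomorphic_transform) (simp add: eq)
  have "log_deriv_quot F6 \<prec>\<^sub>s q c"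
  proof (rule subordinate_q[OF holo])
    fix z assume z: "z \<in> \<D>"
    let ?Q = "log_deriv_quot F6 z"
    show "0 < Re ?Q"
      using close[OF z] abs_Re_le_cmod[of "?Q - 1"] by simp
    have "norm (?Q + 1) \<le> norm (?Q - 1) + 2"
      using norm_triangle_ineq[of "?Q - 1" 2] by (simp add: algebra_simps)
    then have "norm (?Q - 1) * norm (?Q + 1) \<le> 1/4 * (9/4)"
      using close[OF z] by (intro mult_mono) auto
    moreover have "?Q\<^sup>2 - 1 = (?Q - 1) * (?Q + 1)"
      by (simp add: power2_eq_square algebra_simps)
    ultimately show "norm (?Q\<^sup>2 - 1) < c"
      using assms by (simp add: norm_mult)
  qed (use assms in \<open>simp_all add: log_deriv_quot_def\<close>)
  then show ?thesis
    by (simp add: starlike_q_def F6_class_S)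
qed

theorem theorem4p8:
  shows "F6 \<in> starlike_q 1 \<and>
    (\<exists>c\<^sub>0::real.
      (\<forall>c::real.
        (hyp1F2 (1/2) (3/2) 2 (root 3 21 / 2 powr (2/3)))\<^sup>2
          - c * (hyp1F2 (1/2) (3/2) 2 1)\<^sup>2 = 1 \<longleftrightarrow> c = c\<^sub>0) \<and>
      \<bar>c\<^sub>0 - 0.577889\<bar> \<le> 5 / 10 ^ 7 \<and>
      (\<forall>c. c\<^sub>0 < c \<and> c \<le> 1 \<longrightarrow> F6 \<in> starlike_q c))"
proof -
  define A :: real where "A = hyp1F2 (1/2) (3/2) 2 (root 3 21 / 2 powr (2/3))"
  define B :: real where "B = hyp1F2 (1/2) (3/2) 2 1"
  \<comment> \<open>The equation is linear in \<open>c\<close> with slope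
    \<open>- B\<^sup>2\<close>, which is nonzero, so this is its unique root.\<close>
  define c\<^sub>0 where "c\<^sub>0 = (A\<^sup>2 - 1) / B\<^sup>2"
  have A: "1.34559136\<^sup>2 \<le> A\<^sup>2" "A\<^sup>2 \<le> 1.3455915\<^sup>2"
    using hyp1F2_at_critical_point unfolding A_def by (intro power_mono; simp)+
  have B: "1.18436505\<^sup>2 \<le> B\<^sup>2" "B\<^sup>2 \<le> 1.184365051\<^sup>2"
    using hyp1F2_at_1 unfolding B_def by (intro power_mono; simp)+
  have B_pos: "0 < B\<^sup>2" using B(1) by (simp add: power2_eq_square)
  \<comment> \<open>The least \<open>A\<close> is paired with the greatest \<open>B\<close>. With
    the decimals above, the margin is only about 1.4e-8, which is why they are so fine.\<close>
  have lower: "0.5778885 \<le> c\<^sub>0"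
    using A(1) B(2) B_pos unfolding c\<^sub>0_def
    by (simp add: pos_le_divide_eq power_divide)
  have upper: "c\<^sub>0 \<le> 0.5778895"
    using A(2) B(1) B_pos unfolding c\<^sub>0_def
    by (simp add: pos_divide_le_eq power_divide)
  have "A\<^sup>2 - c * B\<^sup>2 = 1 \<longleftrightarrow> c = c\<^sub>0" for c
    using B_pos unfolding c\<^sub>0_def by (auto simp: field_simps)
  moreover have "\<bar>c\<^sub>0 - 0.577889\<bar> \<le> 5 / 10 ^ 7"
    using lower upper unfolding abs_le_iff by simp
  \<comment> \<open>The lower bound on \<open>c\<^sub>0\<close> exceeds 9/16 = 0.5625.\<close>
  moreover have "F6 \<in> starlike_q c" if "c\<^sub>0 < c" "c \<le> 1" for c
    using that lower by (intro F6_starlike_q) auto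
  moreover have "F6 \<in> starlike_q 1"
    by (rule F6_starlike_q) auto
  ultimately show ?thesis
    unfolding A_def B_def by blast
qed

end
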